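(* Let $m>0$, $\mu>0$, $v>0$, let $F:(0,\infty)\to\mathbb{R}\setminus\{0\}$ be the magnitude function of a central force field, and let $\alpha:I\to\mathbb{R}^2\setminus\{0\}$ be a smooth curve parametrized by arc-length $s$ on an interval $I$. Write $r=r(s)=|\alpha(s)|$. Then $\alpha$ is a constant-speed ramp with velocity $v$ for the central force field (with mass $m$ and friction coefficient $\mu$) if and only if for all $s\in I$ one has $\frac{F(r)}{|\alpha(s)|}\langle\alpha(s),\alpha'(s)\rangle\ge 0$ and the curvature $\kappa$ of $\alpha$ satisfies $$\kappa(s)=\frac{F(r)}{m v^2 r}\left(\frac{\langle\alpha(s),\alpha'(s)\rangle}{\mu}+\langle\alpha(s),\mathbf{n}(s)\rangle\right).$$ In particular, if the force is an $n$th power central force, i.e. $F(r)=\varepsilon m r^n$ with $n\in\mathbb{R}$ and $\varepsilon\in\{-1,1\}$, then the curvature equation becomes $$\kappa(s)=\frac{\varepsilon}{v^2}\,r^{n-1}\left(\frac{\langle\alpha(s),\alpha'(s)\rangle}{\mu}+\langle\alpha(s),\mathbf{n}(s)\rangle\right).$$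
   Context: Let $J(x,y)=(-y,x)$. For a curve $\alpha$ in $\mathbb{R}^2$ parametrized by arc-length, $\mathbf{n}(s)=J\alpha'(s)$ is its unit normal and $\kappa(s)=\langle\alpha''(s),\mathbf{n}(s)\rangle$ its (signed) curvature. A central force field is $\mathbf{F}(\mathbf{r})=F(r)\,\mathbf{r}/r$, $r=|\mathbf{r}|$, where $F:(0,\infty)\to\mathbb{R}\setminus\{0\}$. Definition (constant-speed ramp). An arc-length parametrized curve $\alpha:I\to\mathbb{R}^2\setminus\{0\}$ is a constant-speed ramp with velocity $v$ (for mass $m$, friction coefficient $\mu$ and central force $F$) if the motion $\beta(t)=\alpha(vt)$ obeys Newton's second law under the central force, a normal force $\mathbf{N}=\lambda\mathbf{n}$ exerted by the ramp with $\lambda\ge 0$, and the friction force $-\mu\lambda\alpha'$; that is, there is a function $\lambda:I\to[0,\infty)$ with $$m v^2\kappa(s)\mathbf{n}(s)=\frac{F(|\alpha(s)|)}{|\alpha(s)|}\alpha(s)+\lambda(s)\mathbf{n}(s)-\mu\lambda(s)\alpha'(s)\quad\text{for all } s\in I.$$ *)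

theory Defs
  imports "HOL-Analysis.Analysis"
begin

definition J :: "real ^ 2 \<Rightarrow> real ^ 2" where
  "J w = vector [- (w $ 2), w $ 1]"

(* Derivatives are taken within the parameter interval, so they are one-sided at an
   endpoint belonging to I and ordinary derivatives at interior points. *)
definition vderiv_on :: "real set \<Rightarrow> (real \<Rightarrow> real ^ 2) \<Rightarrow> real \<Rightarrow> real ^ 2" where
  "vderiv_on I \<alpha> s = vector_derivative \<alpha> (at s within I)"

definition smooth_curve_on :: "real set \<Rightarrow> (real \<Rightarrow> real ^ 2) \<Rightarrow> bool" where
  "smooth_curve_on I \<alpha> \<longleftrightarrow>
     (\<forall>k. \<forall>s\<in>I. ((vderiv_on I ^^ k) \<alpha>) differentiable (at s within I))"

definition arc_length_curve :: "real set \<Rightarrow> (real \<Rightarrow> real ^ 2) \<Rightarrow> bool" where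
  "arc_length_curve I \<alpha> \<longleftrightarrow>
     smooth_curve_on I \<alpha> \<and> (\<forall>s\<in>I. norm (vderiv_on I \<alpha> s) = 1)"

definition unit_normal :: "real set \<Rightarrow> (real \<Rightarrow> real ^ 2) \<Rightarrow> real \<Rightarrow> real ^ 2" where
  "unit_normal I \<alpha> s = J (vderiv_on I \<alpha> s)"

definition curvature :: "real set \<Rightarrow> (real \<Rightarrow> real ^ 2) \<Rightarrow> real \<Rightarrow> real" where
  "curvature I \<alpha> s = vderiv_on I (vderiv_on I \<alpha>) s \<bullet> unit_normal I \<alpha> s"

(* The equation is Newton's second law for the motion t \<mapsto> \<alpha> (v * t), whose acceleration at
   parameter s = v * t is v^2 times \<alpha>'' s = curvature times unit normal.
   The right-hand side is the sum of the central force, the normal force and the friction.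
   F matters only on positive reals. *)
definition constant_speed_ramp ::
  "real set \<Rightarrow> (real \<Rightarrow> real ^ 2) \<Rightarrow> real \<Rightarrow> real \<Rightarrow> (real \<Rightarrow> real) \<Rightarrow> real \<Rightarrow> bool" where
  "constant_speed_ramp I \<alpha> m \<mu> F v \<longleftrightarrow>
     arc_length_curve I \<alpha> \<and> (\<forall>s\<in>I. \<alpha> s \<noteq> 0) \<and>
     (\<exists>N :: real \<Rightarrow> real. \<forall>s\<in>I. N s \<ge> 0 \<and>
        (m * v\<^sup>2 * curvature I \<alpha> s) *\<^sub>R unit_normal I \<alpha> s =
          (F (norm (\<alpha> s)) / norm (\<alpha> s)) *\<^sub>R \<alpha> s
          + N s *\<^sub>R unit_normal I \<alpha> s
          - (\<mu> * N s) *\<^sub>R vderiv_on I \<alpha> s)"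

end

theory Submission
  imports Defs
begin

text \<open>The tangent and the normal form an orthonormal frame, so Newton's law is equivalent to its
  two frame components. The tangential one determines the normal force as
  \<open>F / (\<mu> r)\<close> times the inner product of the position with the tangent, whose sign gives the
  inequality; substituting this value into the normal component gives the curvature equation.\<close>

lemma inner_J_self [simp]: "w \<bullet> J w = 0" "J w \<bullet> w = 0"
  by (simp_all add: J_def inner_vec_def sum_2)

lemma inner_J_J [simp]: "J x \<bullet> J y = x \<bullet> y"
  by (simp add: J_def inner_vec_def sum_2)

text \<open>Since \<open>J\<close> is a quarter turn, \<open>w\<close> and \<open>J w\<close> are
  orthogonal and of equal length, hence for nonzero \<open>w\<close> a basis of the plane; a vector
  is determined by its inner products with them.\<close>

lemma eq_iff_inner_J:
  assumes "w \<noteq> 0"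
  shows "x = y \<longleftrightarrow> x \<bullet> w = y \<bullet> w \<and> x \<bullet> J w = y \<bullet> J w"
proof
  assume "x \<bullet> w = y \<bullet> w \<and> x \<bullet> J w = y \<bullet> J w"
  then have 0: "(x - y) \<bullet> w = 0" "(x - y) \<bullet> J w = 0"
    by (simp_all add: inner_diff_left)
  define z where "z = x - y"
  \<comment> \<open>Pythagoras in the frame \<open>w\<close>, \<open>J w\<close>, without
    normalizing \<open>w\<close>; in coordinates it is the two-square identity. Both squares vanish
    here, and \<open>w\<close> is nonzero, so \<open>z\<close> has length 0.\<close>
  have "(z \<bullet> z) * (w \<bullet> w) = (z \<bullet> w)\<^sup>2 + (z \<bullet> J w)\<^sup>2"
    by (simp add: J_def inner_vec_def sum_2 power2_eq_square algebra_simps)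
  with 0 assms have "z = 0"
    by (simp add: z_def)
  then show "x = y"
    by (simp add: z_def)
qed simp

text \<open>Newton's law at a single parameter value: \<open>w\<close> is the tangent,
  \<open>a\<close> the position, \<open>c\<close> stands for F/r, \<open>l\<close> for the normal
  force and \<open>k\<close> for m v^2 times the curvature. Friction is the only term besides the
  central force with a tangential component, so that component can be solved for \<open>l\<close>.
  The sign of \<open>l\<close> is left open here.\<close>

lemma force_balance_iff:
  fixes k c l \<mu> :: real
  assumes "norm w = 1" "\<mu> > 0"
  shows "k *\<^sub>R J w = c *\<^sub>R a + l *\<^sub>R J w - (\<mu> * l) *\<^sub>R w \<longleftrightarrow>
    l = c * (a \<bullet> w) / \<mu> \<and> k = c * ((a \<bullet> w) / \<mu> + a \<bullet> J w)"
proof -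
  have w: "w \<bullet> w = 1" "w \<noteq> 0"
    using assms(1) by (auto simp: norm_eq_1)
  \<comment> \<open>The first equation on the right comes from pairing with \<open>w\<close>, the
    second from pairing with \<open>J w\<close>.\<close>
  have "k *\<^sub>R J w = c *\<^sub>R a + l *\<^sub>R J w - (\<mu> * l) *\<^sub>R w \<longleftrightarrow>
      0 = c * (a \<bullet> w) - \<mu> * l \<and> k = c * (a \<bullet> J w) + l"
    using w by (simp add: eq_iff_inner_J[OF w(2)] inner_diff_left inner_add_left)
  also have "\<dots> \<longleftrightarrow> l = c * (a \<bullet> w) / \<mu> \<and> k = c * ((a \<bullet> w) / \<mu> + a \<bullet> J w)"
  proof -
    have "0 = c * (a \<bullet> w) - \<mu> * l \<longleftrightarrow> l = c * (a \<bullet> w) / \<mu>"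
      using assms(2) by (auto simp: field_simps)
    then show ?thesis
      by (auto simp: algebra_simps)
  qed
  finally show ?thesis .
qed

lemma constant_speed_ramp_iff:
  assumes "m > 0" "\<mu> > 0" "v > 0"
    and "arc_length_curve I \<alpha>"
    and "\<And>s. s \<in> I \<Longrightarrow> \<alpha> s \<noteq> 0"
  shows "constant_speed_ramp I \<alpha> m \<mu> F v \<longleftrightarrow>
           (\<forall>s\<in>I. F (norm (\<alpha> s)) / norm (\<alpha> s) * (\<alpha> s \<bullet> vderiv_on I \<alpha> s) \<ge> 0 \<and>
              curvature I \<alpha> s =
                F (norm (\<alpha> s)) / (m * v\<^sup>2 * norm (\<alpha> s)) *
                  ((\<alpha> s \<bullet> vderiv_on I \<alpha> s) / \<mu> + \<alpha> s \<bullet> unit_normal I \<alpha> s))"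
proof -
  let ?T = "vderiv_on I \<alpha>"
  define c where "c s = F (norm (\<alpha> s)) / norm (\<alpha> s)" for s
  have "constant_speed_ramp I \<alpha> m \<mu> F v \<longleftrightarrow>
      (\<exists>N. \<forall>s\<in>I. N s \<ge> 0 \<and> (m * v\<^sup>2 * curvature I \<alpha> s) *\<^sub>R J (?T s) =
        c s *\<^sub>R \<alpha> s + N s *\<^sub>R J (?T s) - (\<mu> * N s) *\<^sub>R ?T s)"
    using assms(4,5) unfolding constant_speed_ramp_def unit_normal_def c_def by blast
  \<comment> \<open>The ramp condition demands no regularity of \<open>N\<close>, so by choice it is
    a separate condition at each point of \<open>I\<close>.\<close>
  also have "\<dots> \<longleftrightarrow> (\<forall>s\<in>I. \<exists>l\<ge>0. (m * v\<^sup>2 * curvature I \<alpha> s) *\<^sub>R J (?T s) =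
        c s *\<^sub>R \<alpha> s + l *\<^sub>R J (?T s) - (\<mu> * l) *\<^sub>R ?T s)"
    by (simp only: bchoice_iff)
  \<comment> \<open>Force balance leaves a single candidate for \<open>l\<close>, so the existence
    of a nonnegative one says that this candidate is nonnegative; as \<mu> > 0, its sign is that of
    the stated product.\<close>
  also have "\<dots> \<longleftrightarrow> (\<forall>s\<in>I. c s * (\<alpha> s \<bullet> ?T s) \<ge> 0 \<and>
      m * v\<^sup>2 * curvature I \<alpha> s = c s * ((\<alpha> s \<bullet> ?T s) / \<mu> + \<alpha> s \<bullet> J (?T s)))"
    using assms(2,4)
    by (intro ball_cong refl)
       (auto simp: arc_length_curve_def force_balance_iff zero_le_divide_iff)
  \<comment> \<open>Division by m v^2 > 0.\<close>
  also have "\<dots> \<longleftrightarrow> (\<forall>s\<in>I. c s * (\<alpha> s \<bullet> ?T s) \<ge> 0 \<and>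
      curvature I \<alpha> s = c s / (m * v\<^sup>2) * ((\<alpha> s \<bullet> ?T s) / \<mu> + \<alpha> s \<bullet> J (?T s)))"
    using assms(1,3) by (intro ball_cong refl conj_cong) (simp add: eq_divide_eq mult.commute)
  finally show ?thesis
    by (simp add: c_def unit_normal_def mult.commute)
qed

theorem theorem2p1:
  fixes m \<mu> v :: real and F :: "real \<Rightarrow> real"
    and I :: "real set" and \<alpha> :: "real \<Rightarrow> real ^ 2"
  assumes "m > 0" and "\<mu> > 0" and "v > 0"
    and "\<And>r. r > 0 \<Longrightarrow> F r \<noteq> 0"
    and "is_interval I" and "\<exists>a\<in>I. \<exists>b\<in>I. a < b"
    and "arc_length_curve I \<alpha>"
    and "\<And>s. s \<in> I \<Longrightarrow> \<alpha> s \<noteq> 0"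
  shows "(constant_speed_ramp I \<alpha> m \<mu> F v \<longleftrightarrow>
           (\<forall>s\<in>I. F (norm (\<alpha> s)) / norm (\<alpha> s) * (\<alpha> s \<bullet> vderiv_on I \<alpha> s) \<ge> 0 \<and>
              curvature I \<alpha> s =
                F (norm (\<alpha> s)) / (m * v\<^sup>2 * norm (\<alpha> s)) *
                  ((\<alpha> s \<bullet> vderiv_on I \<alpha> s) / \<mu> + \<alpha> s \<bullet> unit_normal I \<alpha> s)))
       \<and> (\<forall>(n::real) (\<epsilon>::real).
            \<epsilon> \<in> {-1, 1} \<and> (\<forall>r>0. F r = \<epsilon> * m * r powr n) \<longrightarrow>
              (\<forall>s\<in>I.
                 (curvature I \<alpha> s =
                    F (norm (\<alpha> s)) / (m * v\<^sup>2 * norm (\<alpha> s)) *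
                      ((\<alpha> s \<bullet> vderiv_on I \<alpha> s) / \<mu> + \<alpha> s \<bullet> unit_normal I \<alpha> s))
                 \<longleftrightarrow>
                 (curvature I \<alpha> s =
                    \<epsilon> / v\<^sup>2 * norm (\<alpha> s) powr (n - 1) *
                      ((\<alpha> s \<bullet> vderiv_on I \<alpha> s) / \<mu> + \<alpha> s \<bullet> unit_normal I \<alpha> s)))
              \<and>
              (constant_speed_ramp I \<alpha> m \<mu> F v \<longleftrightarrow>
                 (\<forall>s\<in>I. F (norm (\<alpha> s)) / norm (\<alpha> s) * (\<alpha> s \<bullet> vderiv_on I \<alpha> s) \<ge> 0 \<and>
                    curvature I \<alpha> s =
                      \<epsilon> / v\<^sup>2 * norm (\<alpha> s) powr (n - 1) *
                        ((\<alpha> s \<bullet> vderiv_on I \<alpha> s) / \<mu> + \<alpha> s \<bullet> unit_normal I \<alpha> s))))"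
proof (intro conjI allI impI)
  show ramp_iff: "constant_speed_ramp I \<alpha> m \<mu> F v \<longleftrightarrow>
           (\<forall>s\<in>I. F (norm (\<alpha> s)) / norm (\<alpha> s) * (\<alpha> s \<bullet> vderiv_on I \<alpha> s) \<ge> 0 \<and>
              curvature I \<alpha> s =
                F (norm (\<alpha> s)) / (m * v\<^sup>2 * norm (\<alpha> s)) *
                  ((\<alpha> s \<bullet> vderiv_on I \<alpha> s) / \<mu> + \<alpha> s \<bullet> unit_normal I \<alpha> s))"
    using assms by (intro constant_speed_ramp_iff)
  fix n \<epsilon> :: real
  assume "\<epsilon> \<in> {-1, 1} \<and> (\<forall>r>0. F r = \<epsilon> * m * r powr n)"
  \<comment> \<open>The curve avoids the origin, so the power law applies at r =
    \<open>norm (\<alpha> s)\<close> > 0; then m cancels and r^n / r = r^(n-1).\<close>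
  then have coeff: "F (norm (\<alpha> s)) / (m * v\<^sup>2 * norm (\<alpha> s)) = \<epsilon> / v\<^sup>2 * norm (\<alpha> s) powr (n - 1)"
    if "s \<in> I" for s
    using assms(1,8) that by (simp add: powr_diff)
  then show "\<forall>s\<in>I.
                 (curvature I \<alpha> s =
                    F (norm (\<alpha> s)) / (m * v\<^sup>2 * norm (\<alpha> s)) *
                      ((\<alpha> s \<bullet> vderiv_on I \<alpha> s) / \<mu> + \<alpha> s \<bullet> unit_normal I \<alpha> s))
                 \<longleftrightarrow>
                 (curvature I \<alpha> s =
                    \<epsilon> / v\<^sup>2 * norm (\<alpha> s) powr (n - 1) *
                      ((\<alpha> s \<bullet> vderiv_on I \<alpha> s) / \<mu> + \<alpha> s \<bullet> unit_normal I \<alpha> s))"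
    by simp
  show "constant_speed_ramp I \<alpha> m \<mu> F v \<longleftrightarrow>
                 (\<forall>s\<in>I. F (norm (\<alpha> s)) / norm (\<alpha> s) * (\<alpha> s \<bullet> vderiv_on I \<alpha> s) \<ge> 0 \<and>
                    curvature I \<alpha> s =
                      \<epsilon> / v\<^sup>2 * norm (\<alpha> s) powr (n - 1) *
                        ((\<alpha> s \<bullet> vderiv_on I \<alpha> s) / \<mu> + \<alpha> s \<bullet> unit_normal I \<alpha> s))"
    \<comment> \<open>Only the coefficient in the curvature equation is rewritten; the sign
      condition keeps its form in terms of \<open>F\<close>.\<close>
    unfolding ramp_iff by (intro ball_cong refl) (simp only: coeff)
qed

end
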